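(* Let $m \ge 1$ and $n \ge 2$ be integers, and let $R(x,y) = R_{C(2m,2n)}(x,y)$ be the Riley polynomial of $C(2m,2n)$, i.e. $R(x,y) = S_{-n}(t) - z\,S_{-n-1}(t)$ with $$t = 2 + (y+2-x)(y-2)S_{m-1}^2(y), \qquad z = 1 + (y+2-x)S_{m-1}(y)\,(S_m(y)-S_{m-1}(y)).$$ Then there exist $n-1$ continuous real functions $x_j \colon (2,\infty) \to (0,\infty)$, $1 \le j \le n-1$, in the variable $y$ such that $R(x_j(y),y)=0$ and $$y+2+\frac{4\sin^2\frac{(2j-1)\pi}{4n+2}}{(y-2)S_{m-1}^2(y)} < x_j(y) < y+2+\frac{4\sin^2\frac{(2j+1)\pi}{4n+2}}{(y-2)S_{m-1}^2(y)}$$ for all $y>2$.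
   Context: The Chebyshev polynomials $S_j(v)$, $j \in \mathbb{Z}$, are defined by $S_0(v)=1$, $S_1(v)=v$ and $S_j(v) = vS_{j-1}(v)-S_{j-2}(v)$ for all integers $j$ (so $S_{-1}=0$ and $S_{j}(v) = -S_{-j-2}(v)$). $C(2m,2n)$ is a two-bridge knot in Conway notation; the zero locus of its Riley polynomial, with $x$ the square of the trace of a meridian, describes the nonabelian $\mathrm{SL}_2(\mathbb{C})$-representations of its knot group. Only the explicit formula for $R(x,y)$ is needed for the statement. *)

theory Defs
  imports "HOL-Analysis.Analysis"
begin

text \<open>The polynomials \<open>S\<^sub>j\<close> for \<open>j \<ge> -1\<close>, shifted by one so that the index is a natural number:
  \<open>cheb_S_shift k\<close> is \<open>S\<close> with index \<open>k - 1\<close>.\<close>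

fun cheb_S_shift :: "nat \<Rightarrow> 'a::comm_ring_1 \<Rightarrow> 'a" where
  "cheb_S_shift 0 v = 0"
| "cheb_S_shift (Suc 0) v = 1"
| "cheb_S_shift (Suc (Suc k)) v = v * cheb_S_shift (Suc k) v - cheb_S_shift k v"

text \<open>For \<open>j < -1\<close> the recurrence forces the reflection formula, which is used as the definition;
  \<open>cheb_S_rec\<close> below shows that the recurrence holds for every integer index.\<close>

definition cheb_S :: "int \<Rightarrow> 'a::comm_ring_1 \<Rightarrow> 'a" where
  "cheb_S j v = (if j \<ge> -1 then cheb_S_shift (nat (j + 1)) v
                 else - cheb_S_shift (nat (- j - 1)) v)"

lemma cheb_S_0: "cheb_S 0 v = 1"
  by (simp add: cheb_S_def)

lemma cheb_S_1: "cheb_S 1 v = v"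
  by (simp add: cheb_S_def numeral_2_eq_2)

lemma cheb_S_rec: "cheb_S j v = v * cheb_S (j - 1) v - cheb_S (j - 2) v"
proof -
  consider "j \<ge> 1" | "j = 0" | "j = -1" | "j \<le> -2" by linarith
  then show ?thesis
  proof cases
    case 1
    define k where "k = nat (j - 1)"
    have "j = int k + 1" using 1 by (simp add: k_def)
    then have "nat (j + 1) = Suc (Suc k)" "nat (j - 1 + 1) = Suc k" "nat (j - 2 + 1) = k"
      by simp_all
    then show ?thesis using 1 unfolding cheb_S_def by simp
  next
    case 2
    then show ?thesis by (simp add: cheb_S_def)
  next
    case 3
    then show ?thesis by (simp add: cheb_S_def numeral_2_eq_2)
  next
    case 4
    define k where "k = nat (- j - 1)"
    have "j = - int k - 1" using 4 by (simp add: k_def)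
    then have "nat (- j - 1) = k" "nat (- (j - 1) - 1) = Suc k" "nat (- (j - 2) - 1) = Suc (Suc k)"
      by simp_all
    then show ?thesis using 4 unfolding cheb_S_def by simp
  qed
qed

text \<open>The polynomials \<open>t\<close>, \<open>z\<close> and the Riley polynomial \<open>R\<close> of \<open>C(2m,2n)\<close>, given by their
  values.\<close>

definition riley_t :: "int \<Rightarrow> 'a::comm_ring_1 \<Rightarrow> 'a \<Rightarrow> 'a" where
  "riley_t m x y = 2 + (y + 2 - x) * (y - 2) * (cheb_S (m - 1) y)\<^sup>2"

definition riley_z :: "int \<Rightarrow> 'a::comm_ring_1 \<Rightarrow> 'a \<Rightarrow> 'a" where
  "riley_z m x y = 1 + (y + 2 - x) * cheb_S (m - 1) y * (cheb_S m y - cheb_S (m - 1) y)"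

definition riley :: "int \<Rightarrow> int \<Rightarrow> 'a::comm_ring_1 \<Rightarrow> 'a \<Rightarrow> 'a" where
  "riley m n x y = cheb_S (- n) (riley_t m x y)
                   - riley_z m x y * cheb_S (- n - 1) (riley_t m x y)"

end

theory Submission imports Defs begin

text \<open>
  Substitute \<open>x = y + 2 + 4 sin\<^sup>2 \<alpha> / ((y - 2) S\<^sub>m\<^sub>-\<^sub>1(y)\<^sup>2)\<close>.
  This makes \<open>t = 2 cos 2\<alpha>\<close>, so that the Chebyshev values become quotients of sines, and it
  turns the bounds asked for into bounds on \<open>\<alpha>\<close>. After clearing the denominator \<open>sin 2\<alpha>\<close>,
  the equation \<open>R(x,y) = 0\<close> reads
  \<open>tan 2n\<alpha> tan \<alpha> = w(y)\<close>, where \<open>w = (y - 2) S\<^sub>m\<^sub>-\<^sub>1 / (S\<^sub>m - S\<^sub>m\<^sub>-\<^sub>2)\<close>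
  (lemma \<open>riley_root_of_angle\<close>). The two unknowns are thereby separated: the left side depends on
  \<open>\<alpha>\<close> alone and the right side on \<open>y\<close> alone.

  Since the \<open>S\<^sub>k(y)\<close> increase strictly with \<open>k\<close> for \<open>y > 2\<close>, the number \<open>w(y)\<close>
  lies strictly between \<open>0\<close> and \<open>1\<close> and depends continuously on \<open>y\<close>.
  On the interval from the zero \<open>j\<pi>/(2n)\<close> of \<open>tan 2n\<alpha>\<close> to \<open>(2j+1)\<pi>/(4n+2)\<close> the
  function \<open>tan 2n\<alpha> tan \<alpha>\<close> is continuous and increases strictly from \<open>0\<close> to \<open>1\<close>; the
  value at the right end is \<open>1\<close> because \<open>2n\<alpha>\<close> and \<open>\<alpha>\<close> are there complementary
  angles modulo \<open>\<pi>\<close>. Its inverse function \<open>A\<^sub>j\<close> is continuous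
  (lemma \<open>tan_product_inverse_branch\<close>), and \<open>\<alpha> = A\<^sub>j(w(y))\<close> gives \<open>x\<^sub>j\<close>.
  The lower bound holds because \<open>(2j-1)\<pi>/(4n+2) < j\<pi>/(2n)\<close>.
\<close>

section \<open>Chebyshev values\<close>

lemma cheb_S_shift_trig:
  "cheb_S_shift k (2 * cos \<theta>) * sin \<theta> = sin (real k * \<theta>)" for \<theta> :: real
proof (induction k rule: less_induct)
  case (less k)
  consider "k = 0" | "k = 1" | i where "k = Suc (Suc i)"
    by (metis One_nat_def not0_implies_Suc)
  then show ?case
  proof cases
    case 3
    define \<phi> where "\<phi> = real (Suc i) * \<theta>"
    have "cheb_S_shift (Suc i) (2 * cos \<theta>) * sin \<theta> = sin \<phi>"
      using less[of "Suc i"] 3 by (simp add: \<phi>_def)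
    moreover have "cheb_S_shift i (2 * cos \<theta>) * sin \<theta> = sin (\<phi> - \<theta>)"
      using less[of i] 3 by (simp add: \<phi>_def algebra_simps)
    ultimately have "cheb_S_shift k (2 * cos \<theta>) * sin \<theta>
        = 2 * cos \<theta> * sin \<phi> - sin (\<phi> - \<theta>)"
      using 3 by (simp add: left_diff_distrib mult.assoc)
    also have "\<dots> = sin (\<phi> + \<theta>)"
      by (simp add: sin_add sin_diff)
    also have "\<phi> + \<theta> = real k * \<theta>"
      using 3 by (simp add: \<phi>_def algebra_simps)
    finally show ?thesis .
  qed simp_all
qed

lemma cheb_S_shift_strict_incr:
  fixes y :: real
  assumes "y > 2"
  shows "0 \<le> cheb_S_shift k y \<and> cheb_S_shift k y < cheb_S_shift (Suc k) y"
proof (induction k)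
  case (Suc k)
  then have pos: "cheb_S_shift (Suc k) y > 0" by linarith
  then have "2 * cheb_S_shift (Suc k) y < y * cheb_S_shift (Suc k) y"
    using assms by simp
  with Suc pos show ?case unfolding cheb_S_shift.simps(3) by linarith
qed simp

lemma continuous_on_cheb_S_shift:
  fixes X :: "real set"
  shows "continuous_on X (cheb_S_shift k)"
proof -
  have "continuous_on X (\<lambda>v::real. cheb_S_shift k v)"
    by (induction k rule: induct_nat_012) (auto intro!: continuous_intros)
  then show ?thesis by simp
qed

section \<open>The equation in terms of an angle\<close>

text \<open>Here \<open>p\<close>, \<open>q\<close> and \<open>r\<close> stand for \<open>S\<^sub>m\<^sub>-\<^sub>1(y)\<close>, \<open>S\<^sub>m(y)\<close> and \<open>S\<^sub>m\<^sub>-\<^sub>2(y)\<close>.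
  The hypothesis on \<open>\<alpha>\<close> is \<open>tan 2n\<alpha> tan \<alpha> = (y - 2) p / (q - r)\<close> with all
  denominators cleared.\<close>

lemma riley_root_of_angle:
  fixes m n :: int and y \<alpha> :: real
  defines "p \<equiv> cheb_S (m - 1) y" and "q \<equiv> cheb_S m y" and "r \<equiv> cheb_S (m - 2) y"
  assumes n: "n \<ge> 2" and y: "y \<noteq> 2" and p: "p \<noteq> 0" and nz: "sin (2 * \<alpha>) \<noteq> 0"
    and eq: "(y - 2) * p * (cos (2 * of_int n * \<alpha>) * cos \<alpha>)
             = (q - r) * (sin (2 * of_int n * \<alpha>) * sin \<alpha>)"
  shows "riley m n (y + 2 + 4 * (sin \<alpha>)\<^sup>2 / ((y - 2) * p\<^sup>2)) y = 0"
proof -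
  define x where "x = y + 2 + 4 * (sin \<alpha>)\<^sup>2 / ((y - 2) * p\<^sup>2)"
  have rec: "r = y * p - q"
    using cheb_S_rec[of m y] by (simp add: p_def q_def r_def)
  have "(y + 2 - x) * (y - 2) * p\<^sup>2 = - 4 * (sin \<alpha>)\<^sup>2"
    using y p by (simp add: x_def)
  then have t: "riley_t m x y = 2 * cos (2 * \<alpha>)"
    by (simp add: riley_t_def p_def[symmetric] cos_double_sin)
  have z: "(y - 2) * p * riley_z m x y = (y - 2) * p - 4 * (sin \<alpha>)\<^sup>2 * (q - p)"
    using y p by (simp add: riley_z_def p_def[symmetric] q_def[symmetric] x_def field_simps power2_eq_square)
  define U where "U = cheb_S_shift (nat n) (2 * cos (2 * \<alpha>))"
  define V where "V = cheb_S_shift (nat (n - 1)) (2 * cos (2 * \<alpha>))"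
  define \<phi> where "\<phi> = 2 * of_int n * \<alpha>"
  have U: "U * sin (2 * \<alpha>) = sin \<phi>"
    using cheb_S_shift_trig[of "nat n" "2 * \<alpha>"] n by (simp add: U_def \<phi>_def mult_ac)
  have "V * sin (2 * \<alpha>) = sin (\<phi> - 2 * \<alpha>)"
    using cheb_S_shift_trig[of "nat (n - 1)" "2 * \<alpha>"] n
    by (simp add: V_def \<phi>_def algebra_simps)
  then have V: "V * sin (2 * \<alpha>)
      = sin \<phi> * (1 - 2 * (sin \<alpha>)\<^sup>2) - cos \<phi> * (2 * sin \<alpha> * cos \<alpha>)"
    by (simp add: sin_diff cos_double_sin sin_double)
  have R: "riley m n x y = riley_z m x y * U - V"
    using n by (simp add: riley_def t cheb_S_def U_def V_def)
  have "(y - 2) * p * (riley m n x y * sin (2 * \<alpha>))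
      = ((y - 2) * p * riley_z m x y) * (U * sin (2 * \<alpha>)) - (y - 2) * p * (V * sin (2 * \<alpha>))"
    unfolding R by (simp add: algebra_simps)
  also have "\<dots> = 2 * sin \<alpha> * ((y - 2) * p * (cos \<phi> * cos \<alpha>) - (q - r) * (sin \<phi> * sin \<alpha>))"
    unfolding z U V rec by (simp add: algebra_simps power2_eq_square)
  also have "\<dots> = 0"
    using eq by (simp add: \<phi>_def)
  finally show ?thesis
    using y p nz by (simp add: x_def)
qed

section \<open>Continuous solution of the angle equation\<close>

text \<open>For integral \<open>j\<close>, shifting the argument of the first tangent by \<open>j\<pi>\<close> does not
  change its value. The shift maps \<open>[a, b]\<close> onto \<open>[0, \<pi>/2 - b]\<close>, inside the
  principal branch, so both factors are continuous, nonnegative and strictly increasing, and the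
  product is \<open>tan b cot b = 1\<close> at \<open>b\<close>. The inverse is continuous because
  \<open>[a, b]\<close> is compact.\<close>

lemma tan_product_inverse_branch:
  fixes N j :: real
  assumes j: "0 < j" "j < N"
  defines "a \<equiv> j * pi / (2 * N)" and "b \<equiv> (2 * j + 1) * pi / (4 * N + 2)"
  shows "\<exists>A. continuous_on {0<..<1} A \<and>
    (\<forall>w\<in>{0<..<1}. a < A w \<and> A w < b \<and> tan (2 * N * A w - j * pi) * tan (A w) = w)"
proof -
  define g where "g \<alpha> = tan (2 * N * \<alpha> - j * pi) * tan \<alpha>" for \<alpha>
  have a0: "0 < a" using j by (simp add: a_def)
  have b1: "b < pi / 2"
    using j by (simp add: b_def field_simps)
  have ab: "a < b"
    using j by (simp add: a_def b_def field_simps)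
  have la: "2 * N * a - j * pi = 0"
    using j by (simp add: a_def)
  have lb: "2 * N * b - j * pi = pi / 2 - b"
    using j by (simp add: b_def field_simps)
  have rng: "0 \<le> 2 * N * \<alpha> - j * pi \<and> 2 * N * \<alpha> - j * pi < pi / 2"
    if "\<alpha> \<in> {a..b}" for \<alpha>
  proof -
    have "2 * N * a \<le> 2 * N * \<alpha>" "2 * N * \<alpha> \<le> 2 * N * b"
      using that j by (auto intro: mult_left_mono)
    then show ?thesis using la lb a0 ab by linarith
  qed
  have mono: "g \<alpha> < g \<beta>" if "\<alpha> \<in> {a..b}" "\<beta> \<in> {a..b}" "\<alpha> < \<beta>" for \<alpha> \<beta>
  proof -
    have "2 * N * \<alpha> < 2 * N * \<beta>" using that j by simp
    then have 1: "tan (2 * N * \<alpha> - j * pi) < tan (2 * N * \<beta> - j * pi)"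
      using rng[OF that(1)] rng[OF that(2)] by (intro tan_monotone) auto
    have 2: "tan \<alpha> < tan \<beta>"
      using that a0 b1 by (intro tan_monotone) auto
    have 3: "0 \<le> tan (2 * N * \<alpha> - j * pi)"
      using rng[OF that(1)] by (metis less_eq_real_def tan_gt_zero tan_zero)
    have 4: "0 < tan \<alpha>"
      using that a0 b1 by (intro tan_gt_zero) auto
    show ?thesis
      unfolding g_def using 1 2 3 4 by (intro mult_strict_mono) auto
  qed
  have cont: "continuous_on {a..b} g"
  proof -
    have "cos (2 * N * \<alpha> - j * pi) \<noteq> 0 \<and> cos \<alpha> \<noteq> 0" if "\<alpha> \<in> {a..b}" for \<alpha>
    proof -
      have "0 < cos (2 * N * \<alpha> - j * pi)"
        using rng[OF that] by (intro cos_gt_zero_pi) auto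
      moreover have "0 < cos \<alpha>"
        using that a0 b1 by (intro cos_gt_zero_pi) auto
      ultimately show ?thesis by simp
    qed
    then show ?thesis unfolding g_def by (auto intro!: continuous_intros)
  qed
  have ga: "g a = 0" using la by (simp add: g_def)
  have gb: "g b = 1"
  proof -
    have "tan b > 0" using a0 ab b1 by (intro tan_gt_zero) auto
    then show ?thesis unfolding g_def lb tan_cot by simp
  qed
  define A where "A = the_inv_into {a..b} g"
  have inj: "inj_on g {a..b}"
    by (rule inj_onI) (metis mono less_irrefl linorder_neqE_linordered_idom)
  have img: "{0..1} \<subseteq> g ` {a..b}"
  proof
    fix w :: real assume "w \<in> {0..1}"
    then have "\<exists>\<alpha>\<ge>a. \<alpha> \<le> b \<and> g \<alpha> = w"
      using IVT'[of g a w b] ga gb ab cont by auto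
    then show "w \<in> g ` {a..b}" by auto
  qed
  have "continuous_on (g ` {a..b}) A"
    by (rule continuous_on_inv[OF cont])
       (auto simp: A_def the_inv_into_f_f[OF inj])
  then have 1: "continuous_on {0<..<1} A"
    by (rule continuous_on_subset) (use img in force)
  have 2: "a < A w \<and> A w < b \<and> g (A w) = w" if "w \<in> {0<..<1}" for w
  proof -
    have w: "w \<in> g ` {a..b}" using img that by force
    have "A w \<in> {a..b}"
      unfolding A_def by (rule the_inv_into_into[OF inj w]) simp
    moreover have gA: "g (A w) = w"
      unfolding A_def by (rule f_the_inv_into_f[OF inj w])
    moreover have "A w \<noteq> a" "A w \<noteq> b"
      using gA ga gb that by auto
    ultimately show ?thesis by (auto simp: less_le)
  qed
  show ?thesis using 1 2 unfolding g_def by blast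
qed

section \<open>The root functions\<close>

theorem proposition4p1:
  fixes m n :: int
  assumes "m \<ge> 1" and "n \<ge> 2"
  shows "\<exists>x :: int \<Rightarrow> real \<Rightarrow> real. \<forall>j\<in>{1..n - 1}.
           continuous_on {2<..} (x j) \<and>
           (\<forall>y>2. x j y > 0 \<and>
                  riley m n (x j y) y = 0 \<and>
                  y + 2 + 4 * (sin ((2 * of_int j - 1) * pi / (4 * of_int n + 2)))\<^sup>2
                            / ((y - 2) * (cheb_S (m - 1) y)\<^sup>2) < x j y \<and>
                  x j y < y + 2 + 4 * (sin ((2 * of_int j + 1) * pi / (4 * of_int n + 2)))\<^sup>2
                            / ((y - 2) * (cheb_S (m - 1) y)\<^sup>2))"
proof -
  define p q r :: "real \<Rightarrow> real"
    where "p = cheb_S (m - 1)" and "q = cheb_S m" and "r = cheb_S (m - 2)"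
  define k where "k = nat (m - 1)"
  have m: "m = int k + 1" using assms(1) by (simp add: k_def)
  have shift: "p = cheb_S_shift (Suc k)" "q = cheb_S_shift (Suc (Suc k))" "r = cheb_S_shift k"
    unfolding p_def q_def r_def m by (auto simp: fun_eq_iff cheb_S_def nat_add_distrib)
  define w where "w y = (y - 2) * p y / (q y - r y)" for y
  have p_pos: "p y > 0" if "y > 2" for y
    using cheb_S_shift_strict_incr[OF that, of k] unfolding shift by linarith
  \<comment> \<open>By the recurrence the difference of the two sides is \<open>2 (S\<^sub>m\<^sub>-\<^sub>1 - S\<^sub>m\<^sub>-\<^sub>2)\<close>.\<close>
  have qr: "q y - r y > (y - 2) * p y" if "y > 2" for y
    using cheb_S_shift_strict_incr[OF that, of k] unfolding shift
    by (simp add: algebra_simps)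
  have qr_pos: "q y - r y > 0" if "y > 2" for y
  proof -
    have "(y - 2) * p y > 0" using p_pos[OF that] that by simp
    then show ?thesis using qr[OF that] by linarith
  qed
  have w: "w y \<in> {0<..<1}" if "y > 2" for y
    using qr[OF that] qr_pos[OF that] p_pos[OF that] that by (simp add: w_def)
  have cont_p: "continuous_on X p" and cont_q: "continuous_on X q" and cont_r: "continuous_on X r" for X
    unfolding shift by (rule continuous_on_cheb_S_shift)+
  have cont_w: "continuous_on {2<..} w"
    unfolding w_def using qr_pos
    by (intro continuous_intros cont_p cont_q cont_r) force

  have "\<forall>j\<in>{1..n - 1}. \<exists>A. continuous_on {0<..<1} A \<and>
    (\<forall>w\<in>{0<..<1}. of_int j * pi / (2 * of_int n) < A w
       \<and> A w < (2 * of_int j + 1) * pi / (4 * of_int n + 2)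
       \<and> tan (2 * of_int n * A w - of_int j * pi) * tan (A w) = w)"
    by (intro ballI tan_product_inverse_branch) auto
  then obtain A :: "int \<Rightarrow> real \<Rightarrow> real" where
    A_cont: "\<And>j. j \<in> {1..n - 1} \<Longrightarrow> continuous_on {0<..<1} (A j)" and
    A: "\<And>j w. j \<in> {1..n - 1} \<Longrightarrow> w \<in> {0<..<1} \<Longrightarrow>
        of_int j * pi / (2 * of_int n) < A j w
       \<and> A j w < (2 * of_int j + 1) * pi / (4 * of_int n + 2)
       \<and> tan (2 * of_int n * A j w - of_int j * pi) * tan (A j w) = w"
    by metis
  define x where "x j y = y + 2 + 4 * (sin (A j (w y)))\<^sup>2 / ((y - 2) * (p y)\<^sup>2)" for j y

  have "continuous_on {2<..} (x j)" if j: "j \<in> {1..n - 1}" for j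
  proof -
    have "continuous_on {2<..} (\<lambda>y. A j (w y))"
      by (rule continuous_on_compose2[OF A_cont[OF j] cont_w]) (use w in auto)
    moreover have "(y - 2) * (p y)\<^sup>2 \<noteq> 0" if "y \<in> {2<..}" for y
      using that p_pos[of y] by simp
    ultimately show ?thesis
      unfolding x_def by (intro continuous_intros cont_p) auto
  qed
  moreover have "x j y > 0 \<and> riley m n (x j y) y = 0 \<and>
      y + 2 + 4 * (sin ((2 * of_int j - 1) * pi / (4 * of_int n + 2)))\<^sup>2
        / ((y - 2) * (cheb_S (m - 1) y)\<^sup>2) < x j y \<and>
      x j y < y + 2 + 4 * (sin ((2 * of_int j + 1) * pi / (4 * of_int n + 2)))\<^sup>2
        / ((y - 2) * (cheb_S (m - 1) y)\<^sup>2)" (is "_ \<and> _ \<and> ?low \<and> ?upp")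
    if j: "j \<in> {1..n - 1}" and y: "y > 2" for j y
  proof -
    define \<alpha> where "\<alpha> = A j (w y)"
    define l u :: real where "l = (2 * of_int j - 1) * pi / (4 * of_int n + 2)"
      and "u = (2 * of_int j + 1) * pi / (4 * of_int n + 2)"
    have jn: "1 \<le> real_of_int j" "real_of_int j + 1 \<le> real_of_int n"
      using j by auto
    have \<alpha>: "of_int j * pi / (2 * of_int n) < \<alpha>" "\<alpha> < u"
      and tan_eq: "tan (2 * of_int n * \<alpha> - of_int j * pi) * tan \<alpha> = w y"
      using A[OF j w[OF y]] by (auto simp: \<alpha>_def u_def)
    have "l < of_int j * pi / (2 * of_int n)"
      using jn by (simp add: l_def field_simps add_pos_pos)
    then have l\<alpha>: "l < \<alpha>" using \<alpha> by linarith
    have l0: "0 < l" using jn by (simp add: l_def)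
    have u1: "u < pi / 2" using jn by (simp add: u_def field_simps)
    have D: "(y - 2) * (p y)\<^sup>2 > 0" using y p_pos[OF y] by simp
    have sin_l: "0 < sin l" using l0 l\<alpha> \<alpha> u1 by (intro sin_gt_zero) auto
    have sin_l\<alpha>: "sin l < sin \<alpha>" using l0 l\<alpha> \<alpha> u1 by (intro sin_monotone_2pi) auto
    have sin_\<alpha>u: "sin \<alpha> < sin u" using l0 l\<alpha> \<alpha> u1 by (intro sin_monotone_2pi) auto
    have lo: "(sin l)\<^sup>2 < (sin \<alpha>)\<^sup>2" using sin_l sin_l\<alpha> by (intro power_strict_mono) auto
    have up: "(sin \<alpha>)\<^sup>2 < (sin u)\<^sup>2"
      using sin_l sin_l\<alpha> sin_\<alpha>u by (intro power_strict_mono) auto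
    have x_eq: "x j y = y + 2 + 4 * (sin \<alpha>)\<^sup>2 / ((y - 2) * (p y)\<^sup>2)"
      by (simp add: x_def \<alpha>_def)
    have "?low" "?upp"
      using lo up D unfolding x_eq p_def[symmetric] l_def[symmetric] u_def[symmetric]
      by (simp_all add: divide_strict_right_mono)
    moreover have "x j y > 0"
    proof -
      have "0 \<le> 4 * (sin \<alpha>)\<^sup>2 / ((y - 2) * (p y)\<^sup>2)" using D by simp
      then show ?thesis using y unfolding x_eq by linarith
    qed
    moreover have "riley m n (x j y) y = 0"
    proof -
      have sin2: "sin (2 * \<alpha>) \<noteq> 0"
        using sin_gt_zero[of "2 * \<alpha>"] l0 l\<alpha> \<alpha> u1 by auto
      define \<psi> where "\<psi> = 2 * of_int n * \<alpha> - of_int j * pi"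
      have "w y \<noteq> 0" using w[OF y] by simp
      \<comment> \<open>The tangent is \<open>0\<close> at its poles by convention, so a nonzero product has
        nonzero cosines.\<close>
      then have "cos \<psi> \<noteq> 0" "cos \<alpha> \<noteq> 0"
        using tan_eq by (auto simp: tan_def \<psi>_def)
      then have "w y * (cos \<psi> * cos \<alpha>) = sin \<psi> * sin \<alpha>"
        unfolding tan_eq[symmetric] \<psi>_def[symmetric] by (simp add: tan_def)
      then have \<psi>: "(y - 2) * p y * (cos \<psi> * cos \<alpha>) = (q y - r y) * (sin \<psi> * sin \<alpha>)"
        using qr_pos[OF y] by (simp add: w_def field_simps)
      define e :: real where "e = cos (of_int j * pi)"
      have "2 * of_int n * \<alpha> = \<psi> + of_int j * pi" by (simp add: \<psi>_def)
      moreover have "sin (of_int j * pi) = 0"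
        by (simp add: sin_zero_iff_int2)
      ultimately have "cos (2 * of_int n * \<alpha>) = e * cos \<psi>" "sin (2 * of_int n * \<alpha>) = e * sin \<psi>"
        by (simp_all add: sin_add cos_add e_def)
      then have "(y - 2) * p y * (cos (2 * of_int n * \<alpha>) * cos \<alpha>)
          = (q y - r y) * (sin (2 * of_int n * \<alpha>) * sin \<alpha>)"
        using arg_cong[OF \<psi>, of "\<lambda>s. e * s"] by (simp add: mult_ac)
      then show ?thesis
        unfolding x_eq p_def q_def r_def using assms(2) y p_pos[OF y] sin2
        by (intro riley_root_of_angle) (auto simp: p_def)
    qed
    ultimately show ?thesis by blast
  qed
  ultimately show ?thesis by (intro exI[of _ x]) blast
qed

end
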